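(* Let $a,b$ be positive real numbers with $b>a$ and let $0<\alpha\le 1$. Then $$\left|12A(a^{\alpha+4},b^{\alpha+4}) - 12L_{\alpha+4}(a,b) - (b-a)^2(\alpha+3)(\alpha+4)L_{\alpha+2}(a,b)\right|$$ $$\le \frac{(b-a)^4}{60}(\alpha+1)(\alpha+2)(\alpha+3)(\alpha+4)\max\{|a^{\alpha}|,|b^{\alpha}|\}.$$
   Context: For positive numbers $x,y$, $A(x,y)=\frac{x+y}{2}$. For positive $a\ne b$ and real $r\ne -1,0$, $L_r(a,b)=\frac{b^{r+1}-a^{r+1}}{(r+1)(b-a)}$ (with no outer exponent $1/r$); only indices $r=\alpha+2$ and $r=\alpha+4$ are used. *)

theory Defs
  imports Complex_Main
begin

definition arith_mean :: "real \<Rightarrow> real \<Rightarrow> real" where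
  "arith_mean x y = (x + y) / 2"

text \<open>
  Intended for positive \<open>a \<noteq> b\<close> and \<open>r \<notin> {-1, 0}\<close>. Note that there is no outer
  exponent \<open>1 / r\<close>, in contrast to the usual generalized logarithmic mean.
\<close>
definition log_mean :: "real \<Rightarrow> real \<Rightarrow> real \<Rightarrow> real" where
  "log_mean r a b = (b powr (r + 1) - a powr (r + 1)) / ((r + 1) * (b - a))"

end

theory Submission
  imports Defs
begin

text \<open>
  With \<open>f x = x powr (\<alpha> + 4)\<close> and \<open>h = b - a\<close>, the expression inside the absolute value is
  \<open>- 12 / h\<close> times the error of the end-corrected trapezoidal rule
  \<open>h / 2 * (f a + f b) - h\<^sup>2 / 12 * (f' b - f' a)\<close> for the integral of \<open>f\<close> over \<open>[a, b]\<close>.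
  Regarded as a function of the right end point \<open>x\<close> and multiplied by \<open>x - a\<close>, it vanishes
  together with its first two derivatives at \<open>a\<close> and has third derivative
  \<open>- (x - a)\<^sup>2 * f'''' x\<close>; integrating the bound \<open>M * (x - a)\<^sup>2\<close> three times yields \<open>M * h ^ 5 / 60\<close>.
\<close>

lemma nonneg_from_deriv:
  fixes p q :: "real \<Rightarrow> real"
  assumes "p a = 0"
    and "\<And>x. a \<le> x \<Longrightarrow> x \<le> b \<Longrightarrow> (p has_real_derivative q x) (at x)"
    and "\<And>x. a \<le> x \<Longrightarrow> x \<le> b \<Longrightarrow> 0 \<le> q x"
    and "a \<le> x" "x \<le> b"
  shows "0 \<le> p x"
  using DERIV_nonneg_imp_nondecreasing[of a x p] assms by (metis order_trans)

text \<open>A function that starts at 0 with nonnegative derivative stays nonnegative. Using this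
  three times, from \<open>p3\<close> up to \<open>p0\<close>, replaces repeated integration and so
  avoids any integrability argument.\<close>

lemma nonneg_from_third_deriv:
  fixes p0 p1 p2 p3 :: "real \<Rightarrow> real"
  assumes "p0 a = 0" "p1 a = 0" "p2 a = 0"
    and "\<And>x. a \<le> x \<Longrightarrow> x \<le> b \<Longrightarrow> (p0 has_real_derivative p1 x) (at x)"
    and "\<And>x. a \<le> x \<Longrightarrow> x \<le> b \<Longrightarrow> (p1 has_real_derivative p2 x) (at x)"
    and "\<And>x. a \<le> x \<Longrightarrow> x \<le> b \<Longrightarrow> (p2 has_real_derivative p3 x) (at x)"
    and "\<And>x. a \<le> x \<Longrightarrow> x \<le> b \<Longrightarrow> 0 \<le> p3 x"
    and "a \<le> b"
  shows "0 \<le> p0 b"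
proof -
  have p2: "0 \<le> p2 x" if "a \<le> x" "x \<le> b" for x
    using nonneg_from_deriv[of p2 a b p3] assms that by blast
  have p1: "0 \<le> p1 x" if "a \<le> x" "x \<le> b" for x
    using nonneg_from_deriv[of p1 a b p2] assms p2 that by blast
  show ?thesis
    using nonneg_from_deriv[of p0 a b p1] assms p1 by blast
qed

text \<open>One-sided half of the error estimate: the deviation has third derivative
  \<open>- (x - a)\<^sup>2 * f4 x\<close>, so a lower bound on \<open>f4\<close> bounds it from
  above.\<close>

lemma corrected_trapezoid_upper:
  fixes F f f1 f2 f3 f4 :: "real \<Rightarrow> real"
  assumes "a \<le> b"
    and [derivative_intros]:
      "\<And>x. a \<le> x \<Longrightarrow> x \<le> b \<Longrightarrow> (F has_real_derivative f x) (at x)"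
      "\<And>x. a \<le> x \<Longrightarrow> x \<le> b \<Longrightarrow> (f has_real_derivative f1 x) (at x)"
      "\<And>x. a \<le> x \<Longrightarrow> x \<le> b \<Longrightarrow> (f1 has_real_derivative f2 x) (at x)"
      "\<And>x. a \<le> x \<Longrightarrow> x \<le> b \<Longrightarrow> (f2 has_real_derivative f3 x) (at x)"
      "\<And>x. a \<le> x \<Longrightarrow> x \<le> b \<Longrightarrow> (f3 has_real_derivative f4 x) (at x)"
    and bound: "\<And>x. a \<le> x \<Longrightarrow> x \<le> b \<Longrightarrow> - M \<le> f4 x"
  shows "6 * (b - a) * (f a + f b) - 12 * (F b - F a) - (b - a)\<^sup>2 * (f1 b - f1 a)
         \<le> M * (b - a) ^ 5 / 60"
proof -
  \<comment> \<open>The third derivative of \<open>(x - a) ^ 5\<close> is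
    \<open>60 * (x - a)\<^sup>2\<close>, so \<open>K * (x - a) ^ 5\<close> is the comparison
    function with third derivative \<open>M * (x - a)\<^sup>2\<close>.\<close>
  define K where "K = M / 60"
  then have M: "M = 60 * K"
    by simp
  define p0 where "p0 x = K * (x - a) ^ 5
    - (6 * (x - a) * (f a + f x) - 12 * (F x - F a) - (x - a)\<^sup>2 * (f1 x - f1 a))" for x
  define p1 where "p1 x = 5 * K * (x - a) ^ 4
    - (6 * (f a - f x) + 4 * (x - a) * f1 x + 2 * (x - a) * f1 a - (x - a)\<^sup>2 * f2 x)" for x
  define p2 where "p2 x = 20 * K * (x - a) ^ 3
    - (2 * (f1 a - f1 x) + 2 * (x - a) * f2 x - (x - a)\<^sup>2 * f3 x)" for x
  have "0 \<le> p0 b"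
  proof (rule nonneg_from_third_deriv[of p0 a p1 p2 b "\<lambda>x. (x - a)\<^sup>2 * (M + f4 x)"])
    show "(p0 has_real_derivative p1 x) (at x)" if "a \<le> x" "x \<le> b" for x
      unfolding p0_def [abs_def] p1_def using that
      by (auto intro!: derivative_eq_intros
          simp: algebra_simps power2_eq_square)
    show "(p1 has_real_derivative p2 x) (at x)" if "a \<le> x" "x \<le> b" for x
      unfolding p1_def [abs_def] p2_def using that
      by (auto intro!: derivative_eq_intros
          simp: algebra_simps power2_eq_square)
    \<comment> \<open>The weights 6, 12 and 1 make all \<open>f2\<close> and \<open>f3\<close> terms
      cancel here; only \<open>f4\<close> survives.\<close>
    show "(p2 has_real_derivative (x - a)\<^sup>2 * (M + f4 x)) (at x)" if "a \<le> x" "x \<le> b" for x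
      unfolding p2_def [abs_def] using that
      by (auto intro!: derivative_eq_intros simp: algebra_simps power2_eq_square M)
    show "0 \<le> (x - a)\<^sup>2 * (M + f4 x)" if "a \<le> x" "x \<le> b" for x
      using bound[OF that] by simp
  qed (use \<open>a \<le> b\<close> in \<open>simp_all add: p0_def p1_def p2_def\<close>)
  then show ?thesis
    by (simp add: p0_def M)
qed

lemma corrected_trapezoid_error:
  fixes F f f1 f2 f3 f4 :: "real \<Rightarrow> real"
  assumes "a \<le> b"
    and F: "\<And>x. a \<le> x \<Longrightarrow> x \<le> b \<Longrightarrow> (F has_real_derivative f x) (at x)"
    and f: "\<And>x. a \<le> x \<Longrightarrow> x \<le> b \<Longrightarrow> (f has_real_derivative f1 x) (at x)"
    and f1: "\<And>x. a \<le> x \<Longrightarrow> x \<le> b \<Longrightarrow> (f1 has_real_derivative f2 x) (at x)"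
    and f2: "\<And>x. a \<le> x \<Longrightarrow> x \<le> b \<Longrightarrow> (f2 has_real_derivative f3 x) (at x)"
    and f3: "\<And>x. a \<le> x \<Longrightarrow> x \<le> b \<Longrightarrow> (f3 has_real_derivative f4 x) (at x)"
    and bound: "\<And>x. a \<le> x \<Longrightarrow> x \<le> b \<Longrightarrow> \<bar>f4 x\<bar> \<le> M"
  shows "\<bar>6 * (b - a) * (f a + f b) - 12 * (F b - F a) - (b - a)\<^sup>2 * (f1 b - f1 a)\<bar>
         \<le> M * (b - a) ^ 5 / 60"
proof (rule abs_leI)
  show "6 * (b - a) * (f a + f b) - 12 * (F b - F a) - (b - a)\<^sup>2 * (f1 b - f1 a)
         \<le> M * (b - a) ^ 5 / 60"
    by (rule corrected_trapezoid_upper[OF \<open>a \<le> b\<close> F f f1 f2 f3])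
      (use bound in \<open>simp_all add: abs_le_iff minus_le_iff\<close>)
  \<comment> \<open>The deviation is linear in the function, and \<open>- f4\<close> obeys the same
    bound \<open>M\<close>, so negating the whole chain of derivatives gives the other side.\<close>
  have "6 * (b - a) * (- f a + - f b) - 12 * (- F b - - F a) - (b - a)\<^sup>2 * (- f1 b - - f1 a)
         \<le> M * (b - a) ^ 5 / 60"
    by (rule corrected_trapezoid_upper[OF \<open>a \<le> b\<close> DERIV_minus[OF F] DERIV_minus[OF f]
          DERIV_minus[OF f1] DERIV_minus[OF f2] DERIV_minus[OF f3]])
      (use bound in \<open>simp_all add: abs_le_iff minus_le_iff\<close>)
  then show "- (6 * (b - a) * (f a + f b) - 12 * (F b - F a) - (b - a)\<^sup>2 * (f1 b - f1 a))
         \<le> M * (b - a) ^ 5 / 60"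
    by (simp add: algebra_simps)
qed

lemma DERIV_cmult_powr:
  fixes c r x :: real
  assumes "0 < x"
  shows "((\<lambda>x. c * x powr r) has_real_derivative c * r * x powr (r - 1)) (at x)"
  using assms by (auto intro!: derivative_eq_intros)

theorem theorem3p1:
  fixes a b \<alpha> :: real
  assumes "0 < a" and "0 < b" and "a < b" and "0 < \<alpha>" and "\<alpha> \<le> 1"
  shows "\<bar>12 * arith_mean (a powr (\<alpha> + 4)) (b powr (\<alpha> + 4))
            - 12 * log_mean (\<alpha> + 4) a b
            - (b - a)\<^sup>2 * (\<alpha> + 3) * (\<alpha> + 4) * log_mean (\<alpha> + 2) a b\<bar>
         \<le> (b - a) ^ 4 / 60 * (\<alpha> + 1) * (\<alpha> + 2) * (\<alpha> + 3) * (\<alpha> + 4)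
            * max \<bar>a powr \<alpha>\<bar> \<bar>b powr \<alpha>\<bar>"
    (is "\<bar>?E\<bar> \<le> ?R")
proof -
  \<comment> \<open>Every function is written as \<open>c * x powr r\<close>, even with
    \<open>c = 1\<close> in \<open>f\<close>, so that \<open>DERIV_cmult_powr\<close> settles all
    five derivatives uniformly.\<close>
  define F where "F x = 1 / (\<alpha> + 5) * x powr (\<alpha> + 5)" for x
  define f where "f x = 1 * x powr (\<alpha> + 4)" for x
  define f1 where "f1 x = (\<alpha> + 4) * x powr (\<alpha> + 3)" for x
  define f2 where "f2 x = (\<alpha> + 4) * (\<alpha> + 3) * x powr (\<alpha> + 2)" for x
  define f3 where "f3 x = (\<alpha> + 4) * (\<alpha> + 3) * (\<alpha> + 2) * x powr (\<alpha> + 1)" for x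
  define C where "C = (\<alpha> + 4) * (\<alpha> + 3) * (\<alpha> + 2) * (\<alpha> + 1)"
  let ?m = "max \<bar>a powr \<alpha>\<bar> \<bar>b powr \<alpha>\<bar>"
  let ?D = "6 * (b - a) * (f a + f b) - 12 * (F b - F a) - (b - a)\<^sup>2 * (f1 b - f1 a)"
  have "0 \<le> C"
    using assms by (simp add: C_def)
  have D: "\<bar>?D\<bar> \<le> C * ?m * (b - a) ^ 5 / 60"
  proof (rule corrected_trapezoid_error)
    fix x
    assume x: "a \<le> x" "x \<le> b"
    then have "0 < x"
      using assms by simp
    show "(F has_real_derivative f x) (at x)" "(f has_real_derivative f1 x) (at x)"
      "(f1 has_real_derivative f2 x) (at x)" "(f2 has_real_derivative f3 x) (at x)"
      "(f3 has_real_derivative C * x powr \<alpha>) (at x)"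
      unfolding F_def [abs_def] f_def [abs_def] f1_def [abs_def] f2_def [abs_def] f3_def [abs_def]
        C_def
      by (rule DERIV_cong[OF DERIV_cmult_powr[OF \<open>0 < x\<close>]],
          use assms in \<open>simp add: add.commute\<close>)+
    \<comment> \<open>Since the exponent is positive, the power is increasing and the maximum is
      attained at \<open>b\<close>.\<close>
    have "x powr \<alpha> \<le> b powr \<alpha>"
      using x \<open>0 < x\<close> assms by (intro powr_mono2) auto
    then have "\<bar>x powr \<alpha>\<bar> \<le> ?m"
      by simp
    then show "\<bar>C * x powr \<alpha>\<bar> \<le> C * ?m"
      using \<open>0 \<le> C\<close> by (simp add: abs_mult mult_left_mono)
  qed (use assms in simp)
  \<comment> \<open>\<open>log_mean r a b\<close> is the mean value of \<open>x powr r\<close> over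
    the interval; index \<alpha> + 4 gives the integral of \<open>f\<close>, and index \<alpha> + 2
    below gives, up to constants, that of \<open>f2\<close>.\<close>
  have L4: "(b - a) * log_mean (\<alpha> + 4) a b = F b - F a"
    using assms by (simp add: log_mean_def F_def diff_divide_distrib [symmetric] add.commute)
  have "(b - a) * ((\<alpha> + 3) * log_mean (\<alpha> + 2) a b) = b powr (\<alpha> + 3) - a powr (\<alpha> + 3)"
    using assms by (simp add: log_mean_def add.commute)
  then have L2: "(b - a) * ((\<alpha> + 3) * (\<alpha> + 4) * log_mean (\<alpha> + 2) a b) = f1 b - f1 a"
    by (simp add: f1_def right_diff_distrib [symmetric] mult_ac)
  have "12 * arith_mean (a powr (\<alpha> + 4)) (b powr (\<alpha> + 4)) = 6 * (f a + f b)"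
    by (simp add: arith_mean_def f_def)
  then have "(b - a) * ?E = (b - a) * (6 * (f a + f b)) - 12 * ((b - a) * log_mean (\<alpha> + 4) a b)
      - (b - a)\<^sup>2 * ((b - a) * ((\<alpha> + 3) * (\<alpha> + 4) * log_mean (\<alpha> + 2) a b))"
    by (simp add: right_diff_distrib [of "b - a"] mult_ac)
  then have E: "(b - a) * ?E = ?D"
    unfolding L4 L2 by (simp only: mult_ac)
  have "?R = C * ?m * (b - a) ^ 4 / 60"
    by (simp add: C_def mult_ac)
  \<comment> \<open>One factor \<open>b - a\<close> is split off to match the one multiplying
    \<open>?E\<close>; being positive, it cancels at the end.\<close>
  moreover have "(b - a) ^ 5 = (b - a) * (b - a) ^ 4"
    by (simp flip: power_Suc)
  ultimately have R: "C * ?m * (b - a) ^ 5 / 60 = (b - a) * ?R"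
    by (simp only: mult.left_commute times_divide_eq_right)
  have "(b - a) * \<bar>?E\<bar> = \<bar>?D\<bar>"
    using \<open>a < b\<close> E by (metis abs_mult abs_of_pos diff_gt_0_iff_gt)
  also have "\<dots> \<le> (b - a) * ?R"
    using D by (simp only: R)
  finally show ?thesis
    using \<open>a < b\<close> by (simp only: mult_le_cancel_left_pos diff_gt_0_iff_gt)
qed

end
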